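(* Let $*:\hat S\to\widehat{{}^*S}$ be an enlargement, and let $\mathcal I$ be an $\hat S$-small category. (i) If $\mathcal I$ is cofiltered, then there exists an object $i_{-\infty}\in\mathrm{Ob}({}^*\mathcal I)$, together with a family of morphisms $\{p_i:i_{-\infty}\to{}^*i\}_{i\in\mathrm{Ob}(\mathcal I)}$ in ${}^*\mathcal I$, such that for all morphisms $\varphi:i_1\to i_2$ in $\mathcal I$ one has ${}^*\varphi\circ p_{i_1}=p_{i_2}$. (ii) If $\mathcal I$ is filtered, then there exists an object $i_\infty\in\mathrm{Ob}({}^*\mathcal I)$, together with a family of morphisms $\{\iota_i:{}^*i\to i_\infty\}_{i\in\mathrm{Ob}(\mathcal I)}$ in ${}^*\mathcal I$, such that for all morphisms $\varphi:i_1\to i_2$ in $\mathcal I$ one has $\iota_{i_2}\circ{}^*\varphi=\iota_{i_1}$.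
   Context: Superstructures: a base set $S$ is an infinite set whose elements are not sets; $S_0=S$, $S_n=S_{n-1}\cup\mathcal P(S_{n-1})$, and $\hat S=\bigcup_{n\ge 0}S_n$. Formulas in $\hat S$ are built from $=$, $\in$, constants in $\hat S$, variables, ordered pairs and function application by $\neg$, $\wedge$ and bounded quantifiers $\forall x\in t$; statements are formulas without free variables. For $\varphi$ a formula in $\hat S$, ${}^*\varphi$ is obtained by replacing each constant $\tau$ by ${}^*\tau$. Enlargement: a map $*:\hat S\to\hat W$ between superstructures with (1) ${}^*S=W$; (2) ${}^*s=s$ for $s\in S$; (3) (transfer) a statement $\varphi$ in $\hat S$ is true iff ${}^*\varphi$ is true; (4) (saturation) with $\mathcal J=\bigcup_{A\in\hat S\setminus S}{}^*A$ (the internal elements), every nonempty family $\{U_i\}_{i\in I}$ of nonempty sets $U_i\in\mathcal J$ with $|I|\le|\hat S|$ and the finite intersection property has nonempty intersection. $\hat S$-small category: a category $\mathcal C=\langle M,s,t,c\rangle$ given by its set of morphisms $M\in\hat S\setminus S$, the maps $s,t:M\to M$ sending a morphism to the identity of its source resp. target, and the composition relation $c=\{\langle f,g,h\rangle: f\circ g=h\}$; objects are identified with their identity morphisms. Its enlargement is the category ${}^*\mathcal C=\langle{}^*M,{}^*s,{}^*t,{}^*c\rangle$. A category $\mathcal I$ is cofiltered if it is nonempty; for any two objects $i_1,i_2$ there are morphisms $j\to i_1$, $j\to i_2$; for any $\varphi_1:i_1\to i$, $\varphi_2:i_2\to i$ there are $\psi_1:j\to i_1$, $\psi_2:j\to i_2$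 with $\varphi_1\psi_1=\varphi_2\psi_2$; and for any $\varphi_1,\varphi_2:i_1\to i_2$ there is $\psi:j\to i_1$ with $\varphi_1\psi=\varphi_2\psi$. $\mathcal I$ is filtered if $\mathcal I^\circ$ is cofiltered. *)

theory Defs
  imports "HOL-Library.Equipollence"
begin

text \<open>HOL cannot construct superstructures as types, since their stages grow by iterated power
  sets. They are therefore formed inside an ambient universe of atoms (non-sets) and sets. The
  class is satisfied by every superstructure, which is closed under all the operations below.
  Conversely, separation and power set together provide every subset of every stage over an
  element \<open>S\<close> of the universe, so \<open>S\<close> generates its full superstructure.\<close>

class set_universe =
  fixes elts :: "'a \<Rightarrow> 'a set"
    and atom :: "'a \<Rightarrow> bool"
  assumes elts_atom: "atom x \<Longrightarrow> elts x = {}"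
    and extensionality: "\<not> atom x \<Longrightarrow> \<not> atom y \<Longrightarrow> elts x = elts y \<Longrightarrow> x = y"
    and pairing: "\<exists>z. \<not> atom z \<and> elts z = {x, y}"
    and union: "\<exists>z. \<not> atom z \<and> elts z = (\<Union>y\<in>elts x. elts y)"
    and power_set: "\<exists>z. \<not> atom z \<and> elts z = {y. \<not> atom y \<and> elts y \<subseteq> elts x}"
    and separation: "X \<subseteq> elts x \<Longrightarrow> \<exists>z. \<not> atom z \<and> elts z = X"

text \<open>The set of the universe with the given elements. It is only meaningful for collections
  that do form a set of the universe.\<close>

definition set_of :: "'u::set_universe set \<Rightarrow> 'u" where
  "set_of X = (THE z. \<not> atom z \<and> elts z = X)"

definition pair :: "'u::set_universe \<Rightarrow> 'u \<Rightarrow> 'u" where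
  "pair x y = set_of {set_of {x}, set_of {x, y}}"

definition triple :: "'u::set_universe \<Rightarrow> 'u \<Rightarrow> 'u \<Rightarrow> 'u" where
  "triple x y z = pair (pair x y) z"

text \<open>Function application is total: it yields the empty set if there is no unique value.\<close>

definition app :: "'u::set_universe \<Rightarrow> 'u \<Rightarrow> 'u" where
  "app f x = (if \<exists>!y. pair x y \<in> elts f then THE y. pair x y \<in> elts f else set_of {})"

definition is_map :: "'u::set_universe \<Rightarrow> 'u \<Rightarrow> 'u \<Rightarrow> bool" where
  "is_map f A B \<longleftrightarrow> \<not> atom f
     \<and> elts f \<subseteq> {pair x y | x y. x \<in> elts A \<and> y \<in> elts B}
     \<and> (\<forall>x\<in>elts A. \<exists>!y. pair x y \<in> elts f)"

definition base_set :: "'u::set_universe \<Rightarrow> bool" where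
  "base_set S \<longleftrightarrow> \<not> atom S \<and> infinite (elts S) \<and> (\<forall>x\<in>elts S. atom x)"

primrec stage :: "'u::set_universe \<Rightarrow> nat \<Rightarrow> 'u set" where
  "stage S 0 = elts S"
| "stage S (Suc n) = stage S n \<union> {x. \<not> atom x \<and> elts x \<subseteq> stage S n}"

definition superstructure :: "'u::set_universe \<Rightarrow> 'u set" where
  "superstructure S = (\<Union>n. stage S n)"

datatype 'u trm =
    TConst 'u
  | TVar nat
  | TPair "'u trm" "'u trm"
  | TApp "'u trm" "'u trm"

text \<open>\<open>FAll x t \<phi>\<close> is the bounded quantification \<open>\<forall>x\<in>t. \<phi>\<close>; the variable \<open>x\<close> is bound in
  \<open>\<phi>\<close> but not in \<open>t\<close>.\<close>

datatype 'u fm =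
    FEq "'u trm" "'u trm"
  | FMem "'u trm" "'u trm"
  | FNeg "'u fm"
  | FAnd "'u fm" "'u fm"
  | FAll nat "'u trm" "'u fm"

primrec fv_trm :: "'u trm \<Rightarrow> nat set" where
  "fv_trm (TConst a) = {}"
| "fv_trm (TVar x) = {x}"
| "fv_trm (TPair t u) = fv_trm t \<union> fv_trm u"
| "fv_trm (TApp t u) = fv_trm t \<union> fv_trm u"

primrec fv_fm :: "'u fm \<Rightarrow> nat set" where
  "fv_fm (FEq t u) = fv_trm t \<union> fv_trm u"
| "fv_fm (FMem t u) = fv_trm t \<union> fv_trm u"
| "fv_fm (FNeg \<phi>) = fv_fm \<phi>"
| "fv_fm (FAnd \<phi> \<psi>) = fv_fm \<phi> \<union> fv_fm \<psi>"
| "fv_fm (FAll x t \<phi>) = fv_trm t \<union> (fv_fm \<phi> - {x})"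

primrec eval_trm :: "(nat \<Rightarrow> 'u::set_universe) \<Rightarrow> 'u trm \<Rightarrow> 'u" where
  "eval_trm e (TConst a) = a"
| "eval_trm e (TVar x) = e x"
| "eval_trm e (TPair t u) = pair (eval_trm e t) (eval_trm e u)"
| "eval_trm e (TApp t u) = app (eval_trm e t) (eval_trm e u)"

primrec sat :: "(nat \<Rightarrow> 'u::set_universe) \<Rightarrow> 'u fm \<Rightarrow> bool" where
  "sat e (FEq t u) \<longleftrightarrow> eval_trm e t = eval_trm e u"
| "sat e (FMem t u) \<longleftrightarrow> eval_trm e t \<in> elts (eval_trm e u)"
| "sat e (FNeg \<phi>) \<longleftrightarrow> \<not> sat e \<phi>"
| "sat e (FAnd \<phi> \<psi>) \<longleftrightarrow> sat e \<phi> \<and> sat e \<psi>"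
| "sat e (FAll x t \<phi>) \<longleftrightarrow> (\<forall>a\<in>elts (eval_trm e t). sat (e(x := a)) \<phi>)"

text \<open>The generated functions \<^const>\<open>set_fm\<close> and \<^const>\<open>map_fm\<close> collect, respectively
  replace, the constants of a formula.\<close>

definition statement_in :: "'u::set_universe \<Rightarrow> 'u fm \<Rightarrow> bool" where
  "statement_in S \<phi> \<longleftrightarrow> set_fm \<phi> \<subseteq> superstructure S \<and> fv_fm \<phi> = {}"

definition true_statement :: "'u::set_universe fm \<Rightarrow> bool" where
  "true_statement \<phi> \<longleftrightarrow> (\<forall>e. sat e \<phi>)"

definition internal :: "'u::set_universe \<Rightarrow> ('u \<Rightarrow> 'u) \<Rightarrow> 'u set" where
  "internal S star = (\<Union>A\<in>superstructure S - elts S. elts (star A))"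

text \<open>An index set of cardinality at most that of \<open>superstructure S\<close> is equipotent to a subset
  of it, so it suffices to index families by elements of the universe.\<close>

definition saturated :: "'u::set_universe \<Rightarrow> ('u \<Rightarrow> 'u) \<Rightarrow> bool" where
  "saturated S star \<longleftrightarrow>
     (\<forall>(I :: 'u set) U. I \<noteq> {} \<and> I \<lesssim> superstructure S
        \<and> (\<forall>i\<in>I. U i \<in> internal S star \<and> \<not> atom (U i) \<and> elts (U i) \<noteq> {})
        \<and> (\<forall>J. J \<subseteq> I \<and> finite J \<and> J \<noteq> {} \<longrightarrow> (\<Inter>i\<in>J. elts (U i)) \<noteq> {})
        \<longrightarrow> (\<Inter>i\<in>I. elts (U i)) \<noteq> {})"

definition enlargement :: "'u::set_universe \<Rightarrow> 'u \<Rightarrow> ('u \<Rightarrow> 'u) \<Rightarrow> bool" where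
  "enlargement S W star \<longleftrightarrow>
     base_set S \<and> base_set W \<and> star ` superstructure S \<subseteq> superstructure W
     \<and> star S = W
     \<and> (\<forall>s\<in>elts S. star s = s)
     \<and> (\<forall>\<phi>. statement_in S \<phi> \<longrightarrow> (true_statement \<phi> \<longleftrightarrow> true_statement (map_fm star \<phi>)))
     \<and> saturated S star"

text \<open>All four components are sets of the universe: the set of morphisms, the graphs of the maps
  sending a morphism to the identity of its source and target, and the set of triples
  \<open>(f, g, f \<circ> g)\<close>.\<close>

record 'u cat_data =
  Mor :: 'u
  Src :: 'u
  Tgt :: 'u
  Cmp :: 'u

definition arr :: "'u::set_universe cat_data \<Rightarrow> 'u set" where
  "arr C = elts (Mor C)"

definition src :: "'u::set_universe cat_data \<Rightarrow> 'u \<Rightarrow> 'u" where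
  "src C f = app (Src C) f"

definition tgt :: "'u::set_universe cat_data \<Rightarrow> 'u \<Rightarrow> 'u" where
  "tgt C f = app (Tgt C) f"

text \<open>\<open>composes C f g h\<close> means \<open>f \<circ> g = h\<close>, including that \<open>f \<circ> g\<close> is defined.\<close>

definition composes :: "'u::set_universe cat_data \<Rightarrow> 'u \<Rightarrow> 'u \<Rightarrow> 'u \<Rightarrow> bool" where
  "composes C f g h \<longleftrightarrow> triple f g h \<in> elts (Cmp C)"

definition category :: "'u::set_universe cat_data \<Rightarrow> bool" where
  "category C \<longleftrightarrow>
     \<not> atom (Mor C) \<and> is_map (Src C) (Mor C) (Mor C) \<and> is_map (Tgt C) (Mor C) (Mor C)
     \<and> \<not> atom (Cmp C)
     \<and> elts (Cmp C) \<subseteq> {triple f g h | f g h. f \<in> arr C \<and> g \<in> arr C \<and> h \<in> arr C}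
     \<and> (\<forall>f\<in>arr C. src C (src C f) = src C f \<and> tgt C (src C f) = src C f
                   \<and> src C (tgt C f) = tgt C f \<and> tgt C (tgt C f) = tgt C f)
     \<and> (\<forall>f\<in>arr C. \<forall>g\<in>arr C. (\<exists>h. composes C f g h) \<longleftrightarrow> src C f = tgt C g)
     \<and> (\<forall>f g h h'. composes C f g h \<and> composes C f g h' \<longrightarrow> h = h')
     \<and> (\<forall>f g h. composes C f g h \<longrightarrow> src C h = src C g \<and> tgt C h = tgt C f)
     \<and> (\<forall>f\<in>arr C. composes C f (src C f) f \<and> composes C (tgt C f) f f)
     \<and> (\<forall>f g h u v w. composes C f g u \<and> composes C u h w \<and> composes C g h v
           \<longrightarrow> composes C f v w)"

text \<open>The maps and the relation of a category are subsets of products of its set of morphisms, so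
  they lie in the superstructure as soon as the set of morphisms does.\<close>

definition small_category :: "'u::set_universe \<Rightarrow> 'u cat_data \<Rightarrow> bool" where
  "small_category S C \<longleftrightarrow> category C \<and> Mor C \<in> superstructure S - elts S"

text \<open>Objects are identified with their identity morphisms.\<close>

definition Ob :: "'u::set_universe cat_data \<Rightarrow> 'u set" where
  "Ob C = src C ` arr C"

definition hom :: "'u::set_universe cat_data \<Rightarrow> 'u \<Rightarrow> 'u \<Rightarrow> 'u set" where
  "hom C i j = {f \<in> arr C. src C f = i \<and> tgt C f = j}"

definition opposite :: "'u::set_universe cat_data \<Rightarrow> 'u cat_data" where
  "opposite C = \<lparr>Mor = Mor C, Src = Tgt C, Tgt = Src C,
                 Cmp = set_of {triple g f h | f g h. triple f g h \<in> elts (Cmp C)}\<rparr>"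

definition star_cat :: "('u \<Rightarrow> 'u) \<Rightarrow> 'u::set_universe cat_data \<Rightarrow> 'u cat_data" where
  "star_cat star C = \<lparr>Mor = star (Mor C), Src = star (Src C), Tgt = star (Tgt C),
                      Cmp = star (Cmp C)\<rparr>"

definition cofiltered :: "'u::set_universe cat_data \<Rightarrow> bool" where
  "cofiltered C \<longleftrightarrow>
     Ob C \<noteq> {}
     \<and> (\<forall>i1\<in>Ob C. \<forall>i2\<in>Ob C. \<exists>j\<in>Ob C. hom C j i1 \<noteq> {} \<and> hom C j i2 \<noteq> {})
     \<and> (\<forall>i1\<in>Ob C. \<forall>i2\<in>Ob C. \<forall>i\<in>Ob C. \<forall>\<phi>1\<in>hom C i1 i. \<forall>\<phi>2\<in>hom C i2 i.
          \<exists>j\<in>Ob C. \<exists>\<psi>1\<in>hom C j i1. \<exists>\<psi>2\<in>hom C j i2.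
            \<exists>h. composes C \<phi>1 \<psi>1 h \<and> composes C \<phi>2 \<psi>2 h)
     \<and> (\<forall>i1\<in>Ob C. \<forall>i2\<in>Ob C. \<forall>\<phi>1\<in>hom C i1 i2. \<forall>\<phi>2\<in>hom C i1 i2.
          \<exists>j\<in>Ob C. \<exists>\<psi>\<in>hom C j i1. \<exists>h. composes C \<phi>1 \<psi> h \<and> composes C \<phi>2 \<psi> h)"

definition filtered :: "'u::set_universe cat_data \<Rightarrow> bool" where
  "filtered C \<longleftrightarrow> cofiltered (opposite C)"

end

theory Submission
  imports Defs
begin

text \<open>A cone is encoded as a set \<open>a\<close> of arrows with a common source in which distinct arrows
  have distinct targets; its leg at an object \<open>i\<close> is the unique arrow in \<open>a\<close> with target \<open>i\<close>.
  For an arrow \<open>\<phi>\<close> let \<open>U\<^sub>\<phi>\<close> be the set of all such \<open>a\<close> that have a leg at the source and a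
  leg at the target of \<open>\<phi>\<close> and for which \<open>\<phi>\<close> carries the first to the second. In a cofiltered
  category every finite diagram has a cone (\<open>finite_cone\<close>), so the sets \<open>U\<^sub>\<phi>\<close> have the finite
  intersection property. Transfer carries this over to the internal sets \<open>*U\<^sub>\<phi>\<close>, and there are no more of
  these than elements of \<open>superstructure S\<close>, so saturation yields a single \<open>a\<close> in all of them
  (\<open>star_inter_nonempty\<close>). Transferring the first-order description of \<open>U\<^sub>\<phi>\<close> for each \<open>\<phi>\<close>
  separately shows that the common source of the arrows in \<open>a\<close>, together with its legs at the
  objects \<open>*i\<close>, is as required (\<open>cofiltered_star_cone\<close>). The filtered case is the cofiltered case for the
  opposite category.\<close>

section \<open>Sets and pairs in the universe\<close>

lemma set_of_elts:
  assumes "\<not> atom z"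
  shows "set_of (elts z) = z"
  unfolding set_of_def using assms by (intro the_equality) (auto intro: extensionality)

lemma
  assumes "X \<subseteq> elts z"
  shows not_atom_set_of: "\<not> atom (set_of X)"
    and elts_set_of: "elts (set_of X) = X"
  using separation[OF assms] set_of_elts by metis+

lemma
  shows not_atom_doubleton: "\<not> atom (set_of {x, y})"
    and elts_doubleton: "elts (set_of {x, y}) = {x, y}"
  using pairing[of x y] set_of_elts by metis+

lemma
  shows not_atom_singleton: "\<not> atom (set_of {x})"
    and elts_singleton: "elts (set_of {x}) = {x}"
  using not_atom_doubleton[of x x] elts_doubleton[of x x] by simp_all

lemma not_atom_pair: "\<not> atom (pair x y)"
  and elts_pair: "elts (pair x y) = {set_of {x}, set_of {x, y}}"
  by (simp_all add: pair_def not_atom_doubleton elts_doubleton)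

lemma pair_inject [simp]: "pair x y = pair x' y' \<longleftrightarrow> x = x' \<and> y = y'"
proof
  assume "pair x y = pair x' y'"
  then have "{set_of {x}, set_of {x, y}} = {set_of {x'}, set_of {x', y'}}"
    by (metis elts_pair)
  then have "elts ` {set_of {x}, set_of {x, y}} = elts ` {set_of {x'}, set_of {x', y'}}"
    by simp
  then have "{{x}, {x, y}} = {{x'}, {x', y'}}"
    by (simp add: elts_singleton elts_doubleton)
  then show "x = x' \<and> y = y'"
    by (auto simp: doubleton_eq_iff)
qed simp

lemma triple_inject [simp]: "triple x y z = triple x' y' z' \<longleftrightarrow> x = x' \<and> y = y' \<and> z = z'"
  by (auto simp: triple_def)

lemma app_in_codomain:
  assumes "is_map f A B" and "x \<in> elts A"
  shows "app f x \<in> elts B"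
proof -
  have ex: "\<exists>!y. pair x y \<in> elts f"
    using assms by (simp add: is_map_def)
  then have "pair x (app f x) \<in> elts f"
    unfolding app_def using theI'[OF ex] by simp
  then show ?thesis
    using assms by (auto simp: is_map_def)
qed

section \<open>Superstructures\<close>

text \<open>Each stage is itself a set of the universe, so that all its subsets are sets of the universe
  by separation.\<close>

lemma stage_is_set:
  assumes "base_set S"
  shows "\<exists>z. \<not> atom z \<and> elts z = stage S n"
proof (induction n)
  case 0
  then show ?case using assms by (auto simp: base_set_def)
next
  case (Suc n)
  then obtain z where z: "\<not> atom z" "elts z = stage S n" by blast
  obtain w where w: "\<not> atom w" "elts w = {y. \<not> atom y \<and> elts y \<subseteq> elts z}"
    using power_set[of z] by blast
  obtain v where v: "\<not> atom v" "elts v = {z, w}" using pairing[of z w] by blast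
  show ?case using union[of v] z v w by auto
qed

lemma
  assumes "base_set S" and "X \<subseteq> stage S n"
  shows not_atom_set_of_stage: "\<not> atom (set_of X)"
    and elts_set_of_stage: "elts (set_of X) = X"
    and set_of_in_stage: "set_of X \<in> stage S (Suc n)"
proof -
  obtain z where z: "elts z = stage S n" using stage_is_set[OF assms(1)] by blast
  show 1: "\<not> atom (set_of X)" and 2: "elts (set_of X) = X"
    using assms(2) not_atom_set_of[of X z] elts_set_of[of X z] z by simp_all
  show "set_of X \<in> stage S (Suc n)" using 1 2 assms(2) by simp
qed

lemma stage_transitive:
  assumes "base_set S"
  shows "x \<in> stage S n \<Longrightarrow> elts x \<subseteq> stage S n"
proof (induction n)
  case 0
  then show ?case using assms elts_atom[of x] by (auto simp: base_set_def)
next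
  case (Suc n)
  then show ?case by auto
qed

lemma stage_subset_superstructure: "stage S n \<subseteq> superstructure S"
  by (auto simp: superstructure_def)

lemma not_atom_not_base: "base_set S \<Longrightarrow> \<not> atom x \<Longrightarrow> x \<notin> elts S"
  by (auto simp: base_set_def)

lemma pair_in_stage:
  assumes "x \<in> stage S n" and "y \<in> stage S n"
  shows "pair x y \<in> stage S (Suc (Suc n))"
  using assms
  by (simp add: not_atom_pair elts_pair not_atom_singleton elts_singleton
        not_atom_doubleton elts_doubleton)

lemma triple_in_stage:
  assumes "x \<in> stage S n" and "y \<in> stage S n" and "z \<in> stage S n"
  shows "triple x y z \<in> stage S (n + 4)"
proof -
  have "pair x y \<in> stage S (Suc (Suc n))" and "z \<in> stage S (Suc (Suc n))"
    using pair_in_stage assms by simp_all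
  then show ?thesis
    using pair_in_stage[of "pair x y" S "Suc (Suc n)" z]
    by (simp only: triple_def) (simp add: eval_nat_numeral)
qed

lemma map_in_superstructure:
  assumes "is_map f A B" and "elts A \<subseteq> stage S n" and "elts B \<subseteq> stage S n"
  shows "f \<in> superstructure S"
proof -
  have "elts f \<subseteq> stage S (Suc (Suc n))"
  proof
    fix w assume "w \<in> elts f"
    then have "w \<in> {pair x y | x y. x \<in> elts A \<and> y \<in> elts B}"
      using assms(1) unfolding is_map_def by blast
    then obtain x y where "w = pair x y" "x \<in> stage S n" "y \<in> stage S n"
      using assms(2,3) by blast
    then show "w \<in> stage S (Suc (Suc n))" using pair_in_stage by simp
  qed
  moreover have "\<not> atom f" using assms(1) by (simp add: is_map_def)
  ultimately have "f \<in> stage S (Suc (Suc (Suc n)))" by simp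
  then show ?thesis using stage_subset_superstructure by blast
qed

section \<open>Categories\<close>

lemma
  assumes "category C"
  shows category_not_atom_Mor: "\<not> atom (Mor C)"
    and category_is_map_Src: "is_map (Src C) (Mor C) (Mor C)"
    and category_is_map_Tgt: "is_map (Tgt C) (Mor C) (Mor C)"
    and category_not_atom_Cmp: "\<not> atom (Cmp C)"
    and category_Cmp: "elts (Cmp C) \<subseteq> {triple f g h | f g h. f \<in> arr C \<and> g \<in> arr C \<and> h \<in> arr C}"
    and category_identities: "\<forall>f\<in>arr C. src C (src C f) = src C f \<and> tgt C (src C f) = src C f
          \<and> src C (tgt C f) = tgt C f \<and> tgt C (tgt C f) = tgt C f"
    and category_composable:
      "\<forall>f\<in>arr C. \<forall>g\<in>arr C. (\<exists>h. composes C f g h) \<longleftrightarrow> src C f = tgt C g"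
    and category_deterministic: "\<forall>f g h h'. composes C f g h \<and> composes C f g h' \<longrightarrow> h = h'"
    and category_src_tgt: "\<forall>f g h. composes C f g h \<longrightarrow> src C h = src C g \<and> tgt C h = tgt C f"
    and category_units: "\<forall>f\<in>arr C. composes C f (src C f) f \<and> composes C (tgt C f) f f"
    and category_assoc: "\<forall>f g h u v w. composes C f g u \<and> composes C u h w \<and> composes C g h v
          \<longrightarrow> composes C f v w"
  using assms unfolding category_def by - (elim conjE, assumption)+

lemma
  assumes "category C" and "f \<in> arr C"
  shows src_arr: "src C f \<in> arr C" and tgt_arr: "tgt C f \<in> arr C"
  using app_in_codomain[OF category_is_map_Src] app_in_codomain[OF category_is_map_Tgt] assms
  unfolding arr_def src_def tgt_def by blast+

lemma
  assumes "category C" and "f \<in> arr C"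
  shows src_src: "src C (src C f) = src C f" and tgt_src: "tgt C (src C f) = src C f"
    and src_tgt: "src C (tgt C f) = tgt C f" and tgt_tgt: "tgt C (tgt C f) = tgt C f"
  using category_identities[OF assms(1)] assms(2) by blast+

lemma composes_ex:
  "category C \<Longrightarrow> f \<in> arr C \<Longrightarrow> g \<in> arr C \<Longrightarrow> (\<exists>h. composes C f g h) \<longleftrightarrow> src C f = tgt C g"
  using category_composable by blast

lemma composes_unique:
  "category C \<Longrightarrow> composes C f g h \<Longrightarrow> composes C f g h' \<Longrightarrow> h = h'"
  using category_deterministic by blast

lemma
  assumes "category C" and "composes C f g h"
  shows composes_src: "src C h = src C g" and composes_tgt: "tgt C h = tgt C f"
  using category_src_tgt assms by blast+

lemma composes_arr:
  assumes "category C" and "composes C f g h"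
  shows "f \<in> arr C" and "g \<in> arr C" and "h \<in> arr C"
proof -
  have "triple f g h \<in> {triple f g h | f g h. f \<in> arr C \<and> g \<in> arr C \<and> h \<in> arr C}"
    using category_Cmp assms unfolding composes_def by blast
  then show "f \<in> arr C" and "g \<in> arr C" and "h \<in> arr C" by auto
qed

lemma composes_identity:
  assumes "category C" and "f \<in> arr C"
  shows "composes C f (src C f) f" and "composes C (tgt C f) f f"
  using category_units assms by blast+

lemma composes_assoc:
  assumes "category C" and "composes C f g u" and "composes C u h w" and "composes C g h v"
  shows "composes C f v w"
  using category_assoc assms by blast

text \<open>The associativity axiom passes from \<open>(f \<circ> g) \<circ> h\<close> to \<open>f \<circ> (g \<circ> h)\<close>; the other direction,
  which is the associativity axiom of the opposite category, follows because \<open>u \<circ> h\<close> exists and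
  composites are unique.\<close>

lemma composes_assoc_rev:
  assumes C: "category C" and fv: "composes C f v w" and gh: "composes C g h v"
    and fg: "composes C f g u"
  shows "composes C u h w"
proof -
  have "u \<in> arr C" "h \<in> arr C" "src C u = tgt C h"
    using composes_arr[OF C fg] composes_arr[OF C gh] composes_src[OF C fg]
      composes_ex[OF C, of g h] gh by auto
  then obtain w' where w': "composes C u h w'" using composes_ex[OF C] by blast
  have "composes C f v w'" by (rule composes_assoc[OF C fg w' gh])
  then show ?thesis using composes_unique[OF C fv] w' by simp
qed

lemma Ob_arr: "category C \<Longrightarrow> i \<in> Ob C \<Longrightarrow> i \<in> arr C"
  and Ob_src: "category C \<Longrightarrow> i \<in> Ob C \<Longrightarrow> src C i = i"
  and Ob_tgt: "category C \<Longrightarrow> i \<in> Ob C \<Longrightarrow> tgt C i = i"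
  by (auto simp: Ob_def src_arr src_src tgt_src)

lemma src_Ob: "f \<in> arr C \<Longrightarrow> src C f \<in> Ob C"
  by (simp add: Ob_def)

lemma tgt_Ob: "category C \<Longrightarrow> f \<in> arr C \<Longrightarrow> tgt C f \<in> Ob C"
  unfolding Ob_def by (metis image_eqI src_tgt tgt_arr)

lemma hom_composes:
  assumes "category C" and "f \<in> hom C i k" and "g \<in> hom C j i"
  shows "\<exists>h\<in>hom C j k. composes C f g h"
  using composes_ex[OF assms(1), of f g] assms composes_src composes_tgt composes_arr(3)
  by (fastforce simp: hom_def)

section \<open>Opposite categories\<close>

lemma
  shows arr_opposite [simp]: "arr (opposite C) = arr C"
    and src_opposite [simp]: "src (opposite C) = tgt C"
    and tgt_opposite [simp]: "tgt (opposite C) = src C"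
  by (auto simp: opposite_def arr_def src_def tgt_def)

lemma hom_opposite: "hom (opposite C) i j = hom C j i"
  by (auto simp: hom_def)

lemma Ob_opposite: "category C \<Longrightarrow> Ob (opposite C) = Ob C"
  using src_Ob[of _ C] tgt_Ob[of C] by (auto simp: Ob_def image_iff) (metis Ob_arr Ob_tgt src_Ob)+

lemma small_category_stage:
  assumes "base_set S" and "small_category S C"
  obtains n where "Mor C \<in> stage S n" and "arr C \<subseteq> stage S n"
proof -
  from assms(2) obtain n where "Mor C \<in> stage S n"
    by (auto simp: small_category_def superstructure_def)
  with that stage_transitive[OF assms(1)] show thesis by (simp add: arr_def)
qed

lemma
  assumes "base_set S" and "small_category S C"
  shows elts_Cmp_opposite:
      "elts (Cmp (opposite C)) = {triple g f h | f g h. composes C f g h}"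
    and not_atom_Cmp_opposite: "\<not> atom (Cmp (opposite C))"
proof -
  obtain n where n: "arr C \<subseteq> stage S n" using small_category_stage[OF assms] by blast
  have "category C" using assms by (simp add: small_category_def)
  then have "triple g f h \<in> stage S (n + 4)" if "composes C f g h" for f g h
    using triple_in_stage[of g S n f h] composes_arr[OF _ that] n by blast
  then have "{triple g f h | f g h. composes C f g h} \<subseteq> stage S (n + 4)" by blast
  then show "elts (Cmp (opposite C)) = {triple g f h | f g h. composes C f g h}"
    and "\<not> atom (Cmp (opposite C))"
    using elts_set_of_stage[OF assms(1)] not_atom_set_of_stage[OF assms(1)]
    by (simp_all add: opposite_def composes_def)
qed

lemma composes_opposite:
  assumes "base_set S" and "small_category S C"
  shows "composes (opposite C) g f h \<longleftrightarrow> composes C f g h"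
  by (auto simp: composes_def[of "opposite C"] elts_Cmp_opposite[OF assms])

lemma small_category_opposite:
  assumes "base_set S" and "small_category S C"
  shows "small_category S (opposite C)"
proof -
  note comp = composes_opposite[OF assms]
  have C: "category C" using assms by (simp add: small_category_def)
  have Cmp: "elts (Cmp (opposite C))
      \<subseteq> {triple f g h | f g h. f \<in> arr C \<and> g \<in> arr C \<and> h \<in> arr C}"
    unfolding elts_Cmp_opposite[OF assms] using composes_arr[OF C] by blast
  have data: "Mor (opposite C) = Mor C" "Src (opposite C) = Tgt C" "Tgt (opposite C) = Src C"
    by (simp_all add: opposite_def)
  have "category (opposite C)"
    unfolding category_def arr_opposite src_opposite tgt_opposite comp data
  proof (intro conjI)
    show "\<forall>f g h u v w. composes C g f u \<and> composes C h u w \<and> composes C h g v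
           \<longrightarrow> composes C v f w"
      using composes_assoc_rev[OF C] by blast
    show "\<forall>f\<in>arr C. \<forall>g\<in>arr C. (\<exists>h. composes C g f h) = (tgt C f = src C g)"
      using composes_ex[OF C] by (metis)
    show "\<forall>f g h h'. composes C g f h \<and> composes C g f h' \<longrightarrow> h = h'"
      using composes_unique[OF C] by blast
    show "\<forall>f g h. composes C g f h \<longrightarrow> tgt C h = tgt C g \<and> src C h = src C f"
      using composes_src[OF C] composes_tgt[OF C] by blast
    show "\<forall>f\<in>arr C. tgt C (tgt C f) = tgt C f \<and> src C (tgt C f) = tgt C f
           \<and> tgt C (src C f) = src C f \<and> src C (src C f) = src C f"
      using src_src[OF C] tgt_src[OF C] src_tgt[OF C] tgt_tgt[OF C] by blast
    show "\<forall>f\<in>arr C. composes C (tgt C f) f f \<and> composes C f (src C f) f"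
      using composes_identity[OF C] by blast
  qed (fact category_not_atom_Mor[OF C] category_is_map_Src[OF C] category_is_map_Tgt[OF C]
      Cmp not_atom_Cmp_opposite[OF assms])+
  then show ?thesis using assms by (simp add: small_category_def data)
qed

section \<open>Cones over finite diagrams\<close>

lemma cofiltered_Ob_nonempty: "cofiltered C \<Longrightarrow> Ob C \<noteq> {}"
  by (simp add: cofiltered_def)

lemma cofiltered_lower_bound:
  assumes "cofiltered C" and "i1 \<in> Ob C" and "i2 \<in> Ob C"
  obtains j f g where "j \<in> Ob C" and "f \<in> hom C j i1" and "g \<in> hom C j i2"
  using assms unfolding cofiltered_def by blast

lemma cofiltered_equalize:
  assumes "cofiltered C" and "i1 \<in> Ob C" and "i2 \<in> Ob C"
    and "f \<in> hom C i1 i2" and "g \<in> hom C i1 i2"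
  obtains j k h where "j \<in> Ob C" and "k \<in> hom C j i1" and "composes C f k h" and "composes C g k h"
  using assms unfolding cofiltered_def by blast

text \<open>Precomposing a family of arrows out of \<open>j\<close> with an arrow into \<open>j\<close>.\<close>

lemma precompose_family:
  assumes C: "category C" and "k \<in> hom C l j" and "\<forall>i\<in>X. p i \<in> hom C j i"
  obtains q where "\<forall>i\<in>X. q i \<in> hom C l i \<and> composes C (p i) k (q i)"
proof -
  have "\<forall>i\<in>X. \<exists>h. h \<in> hom C l i \<and> composes C (p i) k h"
    using hom_composes[OF C] assms by blast
  from bchoice[OF this] that show thesis by blast
qed

lemma finite_discrete_cone:
  assumes C: "category C" and cof: "cofiltered C" and "finite X" and "X \<subseteq> Ob C"
  shows "\<exists>j\<in>Ob C. \<exists>p. \<forall>i\<in>X. p i \<in> hom C j i"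
  using assms(3,4)
proof (induction X)
  case empty
  then show ?case using cofiltered_Ob_nonempty[OF cof] by blast
next
  case (insert x X)
  then obtain j p where j: "j \<in> Ob C" and p: "\<forall>i\<in>X. p i \<in> hom C j i" by blast
  from insert have "x \<in> Ob C" by simp
  from cofiltered_lower_bound[OF cof j this] obtain l k g
    where l: "l \<in> Ob C" and k: "k \<in> hom C l j" and g: "g \<in> hom C l x" .
  from precompose_family[OF C k p] obtain q
    where "\<forall>i\<in>X. q i \<in> hom C l i \<and> composes C (p i) k (q i)" .
  with g have "\<forall>i\<in>insert x X. (q(x := g)) i \<in> hom C l i" using insert.hyps by auto
  with l show ?case by blast
qed

text \<open>A cone over the finitely many objects in \<open>X\<close> that commutes with the finitely many arrows in
  \<open>D\<close>: lower bounds give a cone over the objects, which is then made to commute with one arrow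
  after the other.\<close>

lemma finite_cone:
  assumes C: "category C" and cof: "cofiltered C"
    and "finite X" and "X \<subseteq> Ob C" and "finite D" and "D \<subseteq> arr C"
    and "src C ` D \<subseteq> X" and "tgt C ` D \<subseteq> X"
  shows "\<exists>j\<in>Ob C. \<exists>p. (\<forall>i\<in>X. p i \<in> hom C j i)
           \<and> (\<forall>\<phi>\<in>D. composes C \<phi> (p (src C \<phi>)) (p (tgt C \<phi>)))"
  using assms(5-8)
proof (induction D)
  case empty
  then show ?case using finite_discrete_cone[OF C cof assms(3,4)] by simp
next
  case (insert \<phi> D)
  then obtain j p where j: "j \<in> Ob C" and p: "\<forall>i\<in>X. p i \<in> hom C j i"
    and pD: "\<And>\<psi>. \<psi> \<in> D \<Longrightarrow> composes C \<psi> (p (src C \<psi>)) (p (tgt C \<psi>))" by auto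
  have \<phi>: "\<phi> \<in> hom C (src C \<phi>) (tgt C \<phi>)" using insert.prems by (simp add: hom_def)
  have X: "src C \<phi> \<in> X" "tgt C \<phi> \<in> X" using insert.prems by auto
  from hom_composes[OF C \<phi>] p X obtain u
    where u: "u \<in> hom C j (tgt C \<phi>)" "composes C \<phi> (p (src C \<phi>)) u" by blast
  \<comment> \<open>It is enough to equalize the two arrows from the vertex to the target of \<open>\<phi>\<close>, since
    precomposition preserves commutativity at the arrows of \<open>D\<close>.\<close>
  from cofiltered_equalize[OF cof j _ u(1), of "p (tgt C \<phi>)"] p X assms(4)
  obtain l k h where l: "l \<in> Ob C" and k: "k \<in> hom C l j"
    and h: "composes C u k h" "composes C (p (tgt C \<phi>)) k h" by blast
  from precompose_family[OF C k p] obtain q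
    where q: "\<forall>i\<in>X. q i \<in> hom C l i \<and> composes C (p i) k (q i)" .
  have "composes C \<phi> (q (src C \<phi>)) (q (tgt C \<phi>))"
  proof -
    have "q (tgt C \<phi>) = h" using composes_unique[OF C] h(2) q X by blast
    then show ?thesis using composes_assoc[OF C u(2) h(1)] q X by simp
  qed
  moreover have "composes C \<psi> (q (src C \<psi>)) (q (tgt C \<psi>))" if "\<psi> \<in> D" for \<psi>
  proof -
    have "src C \<psi> \<in> X" and "tgt C \<psi> \<in> X" using insert.prems that by auto
    then show ?thesis using composes_assoc[OF C pD[OF that]] q by blast
  qed
  ultimately show ?case using l q by blast
qed

text \<open>\<open>cone_set C \<phi> a\<close>: the set \<open>a\<close> of the universe consists of the legs of a cone, at most one
  leg for each object, and the cone has legs at the source and the target of \<open>\<phi>\<close> that commute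
  with \<open>\<phi>\<close>. Taking the set of legs instead of the function from objects to legs loses nothing,
  as each leg determines its object.\<close>

definition cone_set :: "'u::set_universe cat_data \<Rightarrow> 'u \<Rightarrow> 'u \<Rightarrow> bool" where
  "cone_set C \<phi> a \<longleftrightarrow> \<not> atom a \<and> elts a \<subseteq> arr C
     \<and> (\<forall>x\<in>elts a. \<forall>y\<in>elts a. src C x = src C y \<and> (tgt C x = tgt C y \<longrightarrow> x = y))
     \<and> (\<exists>f\<in>elts a. \<exists>g\<in>elts a. tgt C f = src C \<phi> \<and> tgt C g = tgt C \<phi> \<and> composes C \<phi> f g)"

lemma finite_cone_set:
  assumes C: "category C" and cof: "cofiltered C" and "finite D" and "D \<subseteq> arr C"
  shows "\<exists>a. \<forall>\<phi>\<in>D. cone_set C \<phi> a"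
proof -
  define X where "X = src C ` D \<union> tgt C ` D"
  have X: "finite X" "X \<subseteq> Ob C" "src C ` D \<subseteq> X" "tgt C ` D \<subseteq> X"
    using assms src_Ob tgt_Ob[OF C] by (auto simp: X_def)
  from finite_cone[OF C cof X(1,2) assms(3,4) X(3,4)]
  obtain j p where p: "\<forall>i\<in>X. p i \<in> hom C j i"
    and pD: "\<forall>\<phi>\<in>D. composes C \<phi> (p (src C \<phi>)) (p (tgt C \<phi>))" by (elim bexE exE conjE)
  have hom: "p i \<in> arr C" "src C (p i) = j" "tgt C (p i) = i" if "i \<in> X" for i
    using bspec[OF p that] by (simp_all add: hom_def)
  have "p ` X \<subseteq> elts (Mor C)" using hom(1) by (intro image_subsetI) (simp add: arr_def)
  from separation[OF this] obtain a where a: "\<not> atom a" "elts a = p ` X" by blast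
  have "cone_set C \<phi> a" if "\<phi> \<in> D" for \<phi>
    unfolding cone_set_def
  proof (intro conjI)
    show "elts a \<subseteq> arr C" using hom(1) by (simp add: a(2) image_subset_iff)
    show "\<forall>x\<in>elts a. \<forall>y\<in>elts a. src C x = src C y \<and> (tgt C x = tgt C y \<longrightarrow> x = y)"
      using hom(2,3) by (auto simp: a(2))
    show "\<exists>f\<in>elts a. \<exists>g\<in>elts a. tgt C f = src C \<phi> \<and> tgt C g = tgt C \<phi> \<and> composes C \<phi> f g"
    proof (intro bexI conjI)
      show "composes C \<phi> (p (src C \<phi>)) (p (tgt C \<phi>))" using pD that by blast
    qed (use hom(3) X(3,4) that in \<open>auto simp: a(2)\<close>)
  qed (fact a(1))
  then show ?thesis by blast
qed

section \<open>Transfer and saturation\<close>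

lemma enlargement_base: "enlargement S W star \<Longrightarrow> base_set S"
  by (simp add: enlargement_def)

lemma transfer:
  assumes "enlargement S W star" and "set_fm \<phi> \<subseteq> superstructure S" and "fv_fm \<phi> = {}"
    and "\<And>e. sat e \<phi>"
  shows "sat e (map_fm star \<phi>)"
  using assms by (auto simp: enlargement_def statement_in_def true_statement_def)

lemma star_mem:
  assumes "enlargement S W star" and "x \<in> superstructure S" and "A \<in> superstructure S"
    and "x \<in> elts A"
  shows "star x \<in> elts (star A)"
  using transfer[OF assms(1), of "FMem (TConst x) (TConst A)"] assms by simp

lemma star_nonempty:
  assumes "enlargement S W star" and "A \<in> superstructure S" and "elts A \<noteq> {}"
  shows "elts (star A) \<noteq> {}"
  using transfer[OF assms(1), of "FNeg (FAll 0 (TConst A) (FNeg (FEq (TVar 0) (TVar 0))))"] assms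
  by auto

lemma star_mono:
  assumes "enlargement S W star" and "A \<in> superstructure S" and "B \<in> superstructure S"
    and "elts A \<subseteq> elts B"
  shows "elts (star A) \<subseteq> elts (star B)"
  using transfer[OF assms(1), of "FAll 0 (TConst A) (FMem (TVar 0) (TConst B))"] assms
  by auto

text \<open>The enlargement of any element \<open>A\<close> of the superstructure is internal, being an element of
  \<open>*{A}\<close>.\<close>

lemma star_internal:
  assumes "enlargement S W star" and "A \<in> superstructure S"
  shows "star A \<in> internal S star"
proof -
  have base: "base_set S" using assms(1) by (rule enlargement_base)
  obtain n where "{A} \<subseteq> stage S n" using assms(2) by (auto simp: superstructure_def)
  then have "set_of {A} \<in> superstructure S"
    using set_of_in_stage[OF base] stage_subset_superstructure by blast
  moreover from this have "star A \<in> elts (star (set_of {A}))"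
    using star_mem[OF assms] by (simp add: elts_singleton)
  ultimately show ?thesis
    using not_atom_not_base[OF base not_atom_singleton] by (auto simp: internal_def)
qed

text \<open>Saturation for the enlargements of a family of sets that lie in one stage: transfer carries
  over the finite intersection property, because a finite intersection is again an element of the
  superstructure.\<close>

lemma star_inter_nonempty:
  assumes enl: "enlargement S W star" and "K \<noteq> {}" and "K \<subseteq> superstructure S"
    and sub: "\<And>k. k \<in> K \<Longrightarrow> \<not> atom (U k) \<and> elts (U k) \<subseteq> stage S n"
    and fip: "\<And>J. J \<subseteq> K \<Longrightarrow> finite J \<Longrightarrow> J \<noteq> {} \<Longrightarrow> (\<Inter>k\<in>J. elts (U k)) \<noteq> {}"
  shows "(\<Inter>k\<in>K. elts (star (U k))) \<noteq> {}"
proof -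
  have base: "base_set S" using enl by (rule enlargement_base)
  have in_sup: "U k \<in> superstructure S" if "k \<in> K" for k
    using sub[OF that] stage_subset_superstructure[of S "Suc n"] by auto
  have fip': "(\<Inter>k\<in>J. elts (star (U k))) \<noteq> {}" if J: "J \<subseteq> K" "finite J" "J \<noteq> {}" for J
  proof -
    define V where "V = (\<Inter>k\<in>J. elts (U k))"
    obtain k where "k \<in> J" using J(3) by blast
    then have "V \<subseteq> elts (U k)" and "elts (U k) \<subseteq> stage S n"
      using sub[of k] J(1) by (auto simp: V_def)
    then have "V \<subseteq> stage S n" by (rule subset_trans)
    then have V: "set_of V \<in> superstructure S" "elts (set_of V) = V"
      using set_of_in_stage[OF base] elts_set_of_stage[OF base]
        subsetD[OF stage_subset_superstructure] by metis+
    have "elts (star (set_of V)) \<noteq> {}"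
      using star_nonempty[OF enl V(1)] fip[OF J] by (simp add: V(2)) (simp add: V_def)
    moreover have "elts (star (set_of V)) \<subseteq> elts (star (U k))" if "k \<in> J" for k
    proof (rule star_mono[OF enl V(1) in_sup])
      show "k \<in> K" using that J(1) by blast
      show "elts (set_of V) \<subseteq> elts (U k)" unfolding V(2) using that by (auto simp: V_def)
    qed
    ultimately show ?thesis by (metis INT_greatest subset_empty)
  qed
  have ne: "elts (star (U k)) \<noteq> {}" if "k \<in> K" for k
    using fip'[of "{k}"] that by simp
  have sat: "saturated S star" using enl by (simp add: enlargement_def)
  show ?thesis
  proof (rule mp[OF spec[OF spec[OF sat[unfolded saturated_def], of K], of "\<lambda>k. star (U k)"]],
      intro conjI ballI allI impI)
    show "K \<lesssim> superstructure S" using assms(3) by (rule subset_imp_lepoll)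
    show "star (U k) \<in> internal S star" if "k \<in> K" for k
      by (rule star_internal[OF enl in_sup[OF that]])
    show "\<not> atom (star (U k))" if "k \<in> K" for k using ne[OF that] elts_atom by blast
    show "(\<Inter>k\<in>J. elts (star (U k))) \<noteq> {}" if "J \<subseteq> K \<and> finite J \<and> J \<noteq> {}" for J
      using fip' that by blast
  qed (fact assms(2) ne)+
qed

section \<open>Cones over a cofiltered category in its enlargement\<close>

lemma small_category_superstructure:
  assumes base: "base_set S" and small: "small_category S C"
  shows "Mor C \<in> superstructure S" and "Src C \<in> superstructure S" and "Tgt C \<in> superstructure S"
    and "Cmp C \<in> superstructure S" and "arr C \<subseteq> superstructure S"
proof -
  have C: "category C" using small by (simp add: small_category_def)
  obtain n where n: "Mor C \<in> stage S n" "arr C \<subseteq> stage S n"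
    using small_category_stage[OF assms] .
  show "Mor C \<in> superstructure S" and "arr C \<subseteq> superstructure S"
    using n stage_subset_superstructure by blast+
  show "Src C \<in> superstructure S" and "Tgt C \<in> superstructure S"
    using map_in_superstructure category_is_map_Src[OF C] category_is_map_Tgt[OF C] n(2)
    unfolding arr_def by blast+
  have "{triple f g h | f g h. f \<in> arr C \<and> g \<in> arr C \<and> h \<in> arr C} \<subseteq> stage S (n + 4)"
    using n(2) by (auto intro!: triple_in_stage)
  then have "elts (Cmp C) \<subseteq> stage S (n + 4)" using category_Cmp[OF C] by blast
  moreover have "\<not> atom (Cmp C)" by (rule category_not_atom_Cmp[OF C])
  ultimately have "Cmp C \<in> stage S (Suc (n + 4))" by (simp only: stage.simps) simp
  then show "Cmp C \<in> superstructure S" using stage_subset_superstructure by blast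
qed

text \<open>If all elements of \<open>U\<close> are cone sets at \<open>\<phi>\<close>, then by transfer all elements of \<open>*U\<close> satisfy
  the clauses of \<open>cone_set\<close> in \<open>*C\<close> at \<open>*\<phi>\<close>, with source and target of \<open>*\<phi>\<close> given as \<open>*(src \<phi>)\<close>
  and \<open>*(tgt \<phi>)\<close>.\<close>

lemma star_cone_set:
  assumes enl: "enlargement S W star" and small: "small_category S C" and \<phi>: "\<phi> \<in> arr C"
    and U: "U \<in> superstructure S" "\<And>a. a \<in> elts U \<Longrightarrow> cone_set C \<phi> a"
    and a: "a \<in> elts (star U)"
  defines "D \<equiv> star_cat star C"
  shows "elts a \<subseteq> arr D"
    and "\<forall>x\<in>elts a. \<forall>y\<in>elts a. src D x = src D y \<and> (tgt D x = tgt D y \<longrightarrow> x = y)"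
    and "\<exists>f\<in>elts a. \<exists>g\<in>elts a. tgt D f = star (src C \<phi>) \<and> tgt D g = star (tgt C \<phi>)
           \<and> composes D (star \<phi>) f g"
proof -
  have base: "base_set S" using enl by (rule enlargement_base)
  have C: "category C" using small by (simp add: small_category_def)
  note sup = small_category_superstructure[OF base small]
  have \<phi>_sup: "\<phi> \<in> superstructure S" "src C \<phi> \<in> superstructure S" "tgt C \<phi> \<in> superstructure S"
    using sup(5) \<phi> src_arr[OF C] tgt_arr[OF C] by blast+
  note defs = cone_set_def arr_def src_def tgt_def composes_def triple_def
  have "\<forall>a\<in>elts (star U). \<forall>x\<in>elts a. x \<in> elts (star (Mor C))"
    using transfer[OF enl, of "FAll 0 (TConst U) (FAll 1 (TVar 0) (FMem (TVar 1) (TConst (Mor C))))"]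
      U sup by (auto simp: defs)
  from bspec[OF this a] show "elts a \<subseteq> arr D"
    by (simp add: D_def star_cat_def arr_def subset_iff)
  let ?unique = "FAll 0 (TConst U) (FAll 1 (TVar 0) (FAll 2 (TVar 0) (FAnd
      (FEq (TApp (TConst (Src C)) (TVar 1)) (TApp (TConst (Src C)) (TVar 2)))
      (FNeg (FAnd
        (FEq (TApp (TConst (Tgt C)) (TVar 1)) (TApp (TConst (Tgt C)) (TVar 2)))
        (FNeg (FEq (TVar 1) (TVar 2))))))))"
  have "\<forall>b\<in>elts U. \<forall>x\<in>elts b. \<forall>y\<in>elts b. app (Src C) x = app (Src C) y
          \<and> \<not> (app (Tgt C) x = app (Tgt C) y \<and> \<not> x = y)"
    using U(2) unfolding cone_set_def src_def tgt_def by blast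
  \<comment> \<open>The meaning of the formula is computed without premises: as a premise, the equation between
    the sources of arbitrary \<open>x\<close> and \<open>y\<close> is a rewrite rule that does not terminate.\<close>
  moreover have "sat e ?unique \<longleftrightarrow> (\<forall>b\<in>elts U. \<forall>x\<in>elts b. \<forall>y\<in>elts b.
      app (Src C) x = app (Src C) y \<and> \<not> (app (Tgt C) x = app (Tgt C) y \<and> \<not> x = y))" for e
    by simp
  ultimately have "sat e ?unique" for e by blast
  then have "sat e (map_fm star ?unique)" for e
    by (rule transfer[OF enl, rotated 2]) (use U(1) sup in simp_all)
  moreover have "sat e (map_fm star ?unique) \<longleftrightarrow> (\<forall>b\<in>elts (star U). \<forall>x\<in>elts b. \<forall>y\<in>elts b.
      app (star (Src C)) x = app (star (Src C)) y
      \<and> \<not> (app (star (Tgt C)) x = app (star (Tgt C)) y \<and> \<not> x = y))" for e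
    by simp
  ultimately have "\<forall>b\<in>elts (star U). \<forall>x\<in>elts b. \<forall>y\<in>elts b.
      app (star (Src C)) x = app (star (Src C)) y
      \<and> \<not> (app (star (Tgt C)) x = app (star (Tgt C)) y \<and> \<not> x = y)"
    by blast
  from bspec[OF this a]
  show "\<forall>x\<in>elts a. \<forall>y\<in>elts a. src D x = src D y \<and> (tgt D x = tgt D y \<longrightarrow> x = y)"
    unfolding D_def star_cat_def src_def tgt_def cat_data.simps by blast
  let ?legs = "FAll 0 (TConst U) (FNeg (FAll 1 (TVar 0) (FAll 2 (TVar 0) (FNeg (FAnd
      (FEq (TApp (TConst (Tgt C)) (TVar 1)) (TConst (src C \<phi>))) (FAnd
      (FEq (TApp (TConst (Tgt C)) (TVar 2)) (TConst (tgt C \<phi>)))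
      (FMem (TPair (TPair (TConst \<phi>) (TVar 1)) (TVar 2)) (TConst (Cmp C)))))))))"
  have "\<forall>b\<in>elts U. \<exists>f\<in>elts b. \<exists>g\<in>elts b. app (Tgt C) f = src C \<phi> \<and> app (Tgt C) g = tgt C \<phi>
          \<and> pair (pair \<phi> f) g \<in> elts (Cmp C)"
    using U(2) unfolding cone_set_def tgt_def composes_def triple_def by blast
  then have "sat e ?legs" for e by simp blast
  then have "sat e (map_fm star ?legs)" for e
    by (rule transfer[OF enl, rotated 2]) (use U(1) sup \<phi>_sup in auto)
  then have "\<forall>b\<in>elts (star U). \<exists>f\<in>elts b. \<exists>g\<in>elts b. app (star (Tgt C)) f = star (src C \<phi>)
          \<and> app (star (Tgt C)) g = star (tgt C \<phi>)
          \<and> pair (pair (star \<phi>) f) g \<in> elts (star (Cmp C))"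
    by simp blast
  from bspec[OF this a]
  show "\<exists>f\<in>elts a. \<exists>g\<in>elts a. tgt D f = star (src C \<phi>) \<and> tgt D g = star (tgt C \<phi>)
           \<and> composes D (star \<phi>) f g"
    by (simp add: D_def star_cat_def tgt_def composes_def triple_def)
qed

lemma cofiltered_star_cone:
  assumes enl: "enlargement S W star" and small: "small_category S C" and cof: "cofiltered C"
  defines "D \<equiv> star_cat star C"
  shows "\<exists>v\<in>Ob D. \<exists>p. (\<forall>i\<in>Ob C. p i \<in> hom D v (star i))
      \<and> (\<forall>i1\<in>Ob C. \<forall>i2\<in>Ob C. \<forall>\<phi>\<in>hom C i1 i2. composes D (star \<phi>) (p i1) (p i2))"
proof -
  have base: "base_set S" using enl by (rule enlargement_base)
  have C: "category C" using small by (simp add: small_category_def)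
  obtain n where n: "arr C \<subseteq> stage S n" using small_category_stage[OF base small] .
  define U where "U \<phi> = set_of {a. cone_set C \<phi> a}" for \<phi>
  have U_stage: "{a. cone_set C \<phi> a} \<subseteq> stage S (Suc n)" for \<phi>
    using n by (auto simp: cone_set_def)
  have elts_U: "elts (U \<phi>) = {a. cone_set C \<phi> a}" and not_atom_U: "\<not> atom (U \<phi>)"
    and U_sup: "U \<phi> \<in> superstructure S" for \<phi>
    using elts_set_of_stage[OF base U_stage] not_atom_set_of_stage[OF base U_stage]
      subsetD[OF stage_subset_superstructure set_of_in_stage[OF base U_stage]]
    unfolding U_def by simp_all
  obtain i0 where i0: "i0 \<in> Ob C" using cofiltered_Ob_nonempty[OF cof] by blast
  have "(\<Inter>\<phi>\<in>arr C. elts (star (U \<phi>))) \<noteq> {}"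
  proof (rule star_inter_nonempty[OF enl])
    show "arr C \<noteq> {}" using i0 Ob_arr[OF C] by blast
    show "arr C \<subseteq> superstructure S" using small_category_superstructure[OF base small] by blast
    show "\<not> atom (U \<phi>) \<and> elts (U \<phi>) \<subseteq> stage S (Suc n)" for \<phi>
      using not_atom_U elts_U U_stage by blast
    show "(\<Inter>\<phi>\<in>J. elts (U \<phi>)) \<noteq> {}" if "J \<subseteq> arr C" "finite J" for J
      using finite_cone_set[OF C cof that(2,1)] by (auto simp: elts_U)
  qed
  then obtain a where a: "\<And>\<phi>. \<phi> \<in> arr C \<Longrightarrow> a \<in> elts (star (U \<phi>))" by blast
  have U_cone: "cone_set C \<phi> b" if "b \<in> elts (U \<phi>)" for \<phi> b
    using that by (simp add: elts_U)
  have star_U: "elts a \<subseteq> arr D"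
      "\<forall>x\<in>elts a. \<forall>y\<in>elts a. src D x = src D y \<and> (tgt D x = tgt D y \<longrightarrow> x = y)"
      "\<exists>f\<in>elts a. \<exists>g\<in>elts a. tgt D f = star (src C \<phi>) \<and> tgt D g = star (tgt C \<phi>)
         \<and> composes D (star \<phi>) f g" if "\<phi> \<in> arr C" for \<phi>
    using star_cone_set[OF enl small that U_sup U_cone a[OF that]] unfolding D_def by blast+
  note i0_arr = Ob_arr[OF C i0]
  \<comment> \<open>The leg at \<open>i\<close> exists since \<open>a\<close> is a cone set at the identity arrow \<open>i\<close>.\<close>
  have "\<exists>x. x \<in> elts a \<and> tgt D x = star i" if "i \<in> Ob C" for i
    using star_U(3)[OF Ob_arr[OF C that]] unfolding Ob_src[OF C that] by blast
  then obtain p where p: "\<And>i. i \<in> Ob C \<Longrightarrow> p i \<in> elts a \<and> tgt D (p i) = star i" by metis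
  show ?thesis
  proof (intro bexI exI conjI ballI)
    show "src D (p i0) \<in> Ob D" using p[OF i0] star_U(1)[OF i0_arr] by (auto intro: src_Ob)
    show "p i \<in> hom D (src D (p i0)) (star i)" if "i \<in> Ob C" for i
      using p[OF that] p[OF i0] star_U(1,2)[OF i0_arr] by (auto simp: hom_def)
    show "composes D (star \<phi>) (p i1) (p i2)"
      if "i1 \<in> Ob C" "i2 \<in> Ob C" "\<phi> \<in> hom C i1 i2" for i1 i2 \<phi>
    proof -
      have \<phi>: "\<phi> \<in> arr C" "src C \<phi> = i1" "tgt C \<phi> = i2" using that(3) by (auto simp: hom_def)
      obtain f g where "f \<in> elts a" "g \<in> elts a" "tgt D f = star i1" "tgt D g = star i2"
        and comp: "composes D (star \<phi>) f g" using star_U(3)[OF \<phi>(1)] \<phi>(2,3) by auto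
      then have "f = p i1" and "g = p i2"
        using star_U(2)[OF \<phi>(1)] p[OF that(1)] p[OF that(2)] by metis+
      then show ?thesis using comp by simp
    qed
  qed
qed

section \<open>Limits in the enlargement\<close>

lemma
  shows arr_star_opposite [simp]: "arr (star_cat star (opposite C)) = arr (star_cat star C)"
    and hom_star_opposite: "hom (star_cat star (opposite C)) i j = hom (star_cat star C) j i"
  by (auto simp: star_cat_def opposite_def arr_def hom_def src_def tgt_def)

text \<open>The composition relation of \<open>*(C\<^sup>o\<^sup>p)\<close> is the enlargement of a relation other than that of
  \<open>C\<close>, so that its agreement with the reversed composition of \<open>*C\<close> needs transfer.\<close>

lemma composes_star_opposite:
  assumes enl: "enlargement S W star" and small: "small_category S C"
    and "f \<in> arr (star_cat star C)" and "g \<in> arr (star_cat star C)" and "h \<in> arr (star_cat star C)"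
    and "composes (star_cat star (opposite C)) g f h"
  shows "composes (star_cat star C) f g h"
proof -
  have base: "base_set S" using enl by (rule enlargement_base)
  note sup = small_category_superstructure[OF base small]
    small_category_superstructure(4)[OF base small_category_opposite[OF base small]]
  have comp: "pair (pair g f) h \<in> elts (Cmp (opposite C)) \<longleftrightarrow> pair (pair f g) h \<in> elts (Cmp C)"
    for f g h
    using composes_opposite[OF base small] by (simp add: composes_def triple_def)
  have "\<forall>f\<in>elts (star (Mor C)). \<forall>g\<in>elts (star (Mor C)). \<forall>h\<in>elts (star (Mor C)).
      \<not> (pair (pair g f) h \<in> elts (star (Cmp (opposite C)))
         \<and> pair (pair f g) h \<notin> elts (star (Cmp C)))"
    using transfer[OF enl, of "FAll 0 (TConst (Mor C)) (FAll 1 (TConst (Mor C))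
        (FAll 2 (TConst (Mor C)) (FNeg (FAnd
          (FMem (TPair (TPair (TVar 1) (TVar 0)) (TVar 2)) (TConst (Cmp (opposite C))))
          (FNeg (FMem (TPair (TPair (TVar 0) (TVar 1)) (TVar 2)) (TConst (Cmp C))))))))"]
      sup by (auto simp: comp)
  then show ?thesis
    using assms(3-) by (auto simp: star_cat_def arr_def composes_def triple_def)
qed

text \<open>Objects are defined as sources, while the vertex of a cocone arises as a target.\<close>

lemma star_tgt_Ob:
  assumes enl: "enlargement S W star" and small: "small_category S C"
    and f: "f \<in> arr (star_cat star C)"
  shows "tgt (star_cat star C) f \<in> Ob (star_cat star C)"
proof -
  have base: "base_set S" using enl by (rule enlargement_base)
  have C: "category C" using small by (simp add: small_category_def)
  have "app (Src C) (app (Tgt C) f) = app (Tgt C) f \<and> app (Tgt C) f \<in> elts (Mor C)"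
    if "f \<in> elts (Mor C)" for f
    using src_tgt[OF C, of f] tgt_arr[OF C, of f] that by (simp add: src_def tgt_def arr_def)
  then have "\<forall>f\<in>elts (star (Mor C)). app (star (Src C)) (app (star (Tgt C)) f) = app (star (Tgt C)) f
      \<and> app (star (Tgt C)) f \<in> elts (star (Mor C))"
    using transfer[OF enl, of "FAll 0 (TConst (Mor C)) (FAnd
        (FEq (TApp (TConst (Src C)) (TApp (TConst (Tgt C)) (TVar 0))) (TApp (TConst (Tgt C)) (TVar 0)))
        (FMem (TApp (TConst (Tgt C)) (TVar 0)) (TConst (Mor C))))"]
      small_category_superstructure[OF base small] by auto
  then show ?thesis
    using f unfolding Ob_def
    by (intro image_eqI[of _ _ "tgt (star_cat star C) f"])
      (auto simp: star_cat_def src_def tgt_def arr_def)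
qed

lemma filtered_star_cocone:
  assumes enl: "enlargement S W star" and small: "small_category S C" and fil: "filtered C"
  defines "D \<equiv> star_cat star C"
  shows "\<exists>v\<in>Ob D. \<exists>\<iota>. (\<forall>i\<in>Ob C. \<iota> i \<in> hom D (star i) v)
      \<and> (\<forall>i1\<in>Ob C. \<forall>i2\<in>Ob C. \<forall>\<phi>\<in>hom C i1 i2. composes D (\<iota> i2) (star \<phi>) (\<iota> i1))"
proof -
  have base: "base_set S" using enl by (rule enlargement_base)
  have C: "category C" using small by (simp add: small_category_def)
  let ?D' = "star_cat star (opposite C)"
  from cofiltered_star_cone[OF enl small_category_opposite[OF base small]] fil
  obtain v p where v: "v \<in> Ob ?D'" and p: "\<And>i. i \<in> Ob C \<Longrightarrow> p i \<in> hom ?D' v (star i)"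
    and comp: "\<And>i1 i2 \<phi>. i1 \<in> Ob C \<Longrightarrow> i2 \<in> Ob C \<Longrightarrow> \<phi> \<in> hom (opposite C) i1 i2
        \<Longrightarrow> composes ?D' (star \<phi>) (p i1) (p i2)"
    unfolding filtered_def Ob_opposite[OF C] by metis
  have hom: "p i \<in> hom D (star i) v" if "i \<in> Ob C" for i
    using p[OF that] by (simp add: D_def hom_star_opposite)
  show ?thesis
  proof (intro bexI exI conjI ballI)
    show "v \<in> Ob D"
      using v star_tgt_Ob[OF enl small]
      by (auto simp: Ob_def D_def) (simp add: opposite_def star_cat_def src_def tgt_def)
    show "p i \<in> hom D (star i) v" if "i \<in> Ob C" for i by (rule hom[OF that])
    show "composes D (p i2) (star \<phi>) (p i1)"
      if i: "i1 \<in> Ob C" "i2 \<in> Ob C" and \<phi>: "\<phi> \<in> hom C i1 i2" for i1 i2 \<phi>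
      unfolding D_def
    proof (rule composes_star_opposite[OF enl small])
      show "composes ?D' (star \<phi>) (p i2) (p i1)"
        using comp[OF i(2,1)] \<phi> by (simp add: hom_opposite)
      have "\<phi> \<in> elts (Mor C)" using \<phi> by (simp add: hom_def arr_def)
      then show "star \<phi> \<in> arr (star_cat star C)"
        using star_mem[OF enl] small_category_superstructure[OF base small]
        by (auto simp: star_cat_def arr_def)
    qed (use hom i in \<open>simp_all add: hom_def D_def\<close>)
  qed
qed

theorem proposition3p1:
  fixes S :: "'u::set_universe" and star :: "'u \<Rightarrow> 'u" and I :: "'u cat_data"
  assumes "enlargement S (star S) star"
    and "small_category S I"
  shows "(cofiltered I \<longrightarrow>
            (\<exists>i_minf\<in>Ob (star_cat star I). \<exists>p :: 'u \<Rightarrow> 'u.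
               (\<forall>i\<in>Ob I. p i \<in> hom (star_cat star I) i_minf (star i))
               \<and> (\<forall>i1\<in>Ob I. \<forall>i2\<in>Ob I. \<forall>\<phi>\<in>hom I i1 i2.
                    composes (star_cat star I) (star \<phi>) (p i1) (p i2))))
       \<and> (filtered I \<longrightarrow>
            (\<exists>i_inf\<in>Ob (star_cat star I). \<exists>\<iota> :: 'u \<Rightarrow> 'u.
               (\<forall>i\<in>Ob I. \<iota> i \<in> hom (star_cat star I) (star i) i_inf)
               \<and> (\<forall>i1\<in>Ob I. \<forall>i2\<in>Ob I. \<forall>\<phi>\<in>hom I i1 i2.
                    composes (star_cat star I) (\<iota> i2) (star \<phi>) (\<iota> i1))))"
  using cofiltered_star_cone[OF assms] filtered_star_cocone[OF assms] by blast

end
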